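(* Let $f:[0,\infty)\to\mathbb{R}$ be a superquadratic function and let $\varphi:[0,\infty)\to\mathbb{R}$ be a function such that $f(y)\ge f(x)+\varphi(x)(y-x)+f(|y-x|)$ for all $x,y\ge0$. Let $x_1,\dots,x_n\ge 0$, let $(a_1,\dots,a_n)$ be a nonnegative $n$-tuple with $A_n=\sum_{i=1}^n a_i>0$, let $\overline{x}=\frac{1}{A_n}\sum_{i=1}^n a_ix_i$, and let $\lambda_i\in[0,1]$, $i=1,\dots,n$. Then $$\frac{1}{A_n}\sum_{i=1}^n a_if(x_i)-\frac{1}{A_n}\sum_{i=1}^n a_if\big((1-\lambda_i)\overline{x}+\lambda_ix_i\big)$$ $$\le\frac{1}{A_n}\sum_{i=1}^n a_i(1-\lambda_i)\varphi(x_i)(x_i-\overline{x})-\frac{1}{A_n}\sum_{i=1}^n a_if\big((1-\lambda_i)|\overline{x}-x_i|\big).$$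
   Context: A function $f:[0,\infty)\to\mathbb{R}$ is superquadratic if for every $x\ge0$ there is a constant $C_x\in\mathbb{R}$ such that $f(y)\ge f(x)+C_x(y-x)+f(|y-x|)$ for all $y\ge0$; thus $\varphi(x)=C_x$ is a choice of such constants. *)

theory Defs
  imports Complex_Main
begin

text \<open>A function on $[0,\infty)$ is represented by a total function on the reals, of which
  only the values at nonnegative arguments are ever used.\<close>

definition superquadratic :: "(real \<Rightarrow> real) \<Rightarrow> bool" where
  "superquadratic f \<longleftrightarrow>
     (\<forall>x\<ge>0. \<exists>C::real. \<forall>y\<ge>0. f y \<ge> f x + C * (y - x) + f \<bar>y - x\<bar>)"

end

theory Submission
  imports Defs
begin

(* The defining inequality at s = x_i, t = (1 - lam_i) xbar + lam_i x_i is the i-th summand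
   of the claim, because t - s = (1 - lam_i) (xbar - x_i). *)

text \<open>The inequality holds term by term, before any averaging. Each point
  \<open>(1 - lam i) * xbar + lam i * x i\<close> lies between \<open>xbar\<close> and
  \<open>x i\<close>, so the superquadratic bound based at \<open>x i\<close> controls
  \<open>f (x i)\<close> by the value of \<open>f\<close> there. Weighting by
  \<open>a i \<ge> 0\<close>, summing and dividing by \<open>A > 0\<close> preserve the
  inequality.\<close>

theorem theorem18:
  fixes f \<phi> :: "real \<Rightarrow> real"
    and n :: nat
    and x a lam :: "nat \<Rightarrow> real"
    and A xbar :: real
  assumes "superquadratic f"
    and "\<And>s t. s \<ge> 0 \<Longrightarrow> t \<ge> 0 \<Longrightarrow> f t \<ge> f s + \<phi> s * (t - s) + f \<bar>t - s\<bar>"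
    and "\<And>i. i \<in> {1..n} \<Longrightarrow> x i \<ge> 0"
    and "\<And>i. i \<in> {1..n} \<Longrightarrow> a i \<ge> 0"
    and "A = (\<Sum>i=1..n. a i)"
    and "A > 0"
    and "xbar = 1 / A * (\<Sum>i=1..n. a i * x i)"
    and "\<And>i. i \<in> {1..n} \<Longrightarrow> lam i \<in> {0..1}"
  shows "1 / A * (\<Sum>i=1..n. a i * f (x i))
           - 1 / A * (\<Sum>i=1..n. a i * f ((1 - lam i) * xbar + lam i * x i))
         \<le> 1 / A * (\<Sum>i=1..n. a i * (1 - lam i) * \<phi> (x i) * (x i - xbar))
           - 1 / A * (\<Sum>i=1..n. a i * f ((1 - lam i) * \<bar>xbar - x i\<bar>))"
proof -
  \<comment> \<open>This keeps each \<open>t\<close> below in the domain of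
    \<open>f\<close>.\<close>
  have xbar: "xbar \<ge> 0"
    unfolding assms(7) using assms(3,4,6)
    by (intro mult_nonneg_nonneg sum_nonneg) auto
  have "a i * f (x i) - a i * f ((1 - lam i) * xbar + lam i * x i)
      \<le> a i * (1 - lam i) * \<phi> (x i) * (x i - xbar) - a i * f ((1 - lam i) * \<bar>xbar - x i\<bar>)"
    if i: "i \<in> {1..n}" for i
  proof -
    define t where "t = (1 - lam i) * xbar + lam i * x i"
    have lam: "0 \<le> lam i" "lam i \<le> 1"
      using assms(8)[OF i] by auto
    have "t \<ge> 0"
      unfolding t_def using lam xbar assms(3)[OF i] by simp
    moreover have diff: "t - x i = (1 - lam i) * (xbar - x i)"
      by (simp add: t_def algebra_simps)
    \<comment> \<open>The factor \<open>1 - lam i\<close> leaves the absolute value because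
      \<open>lam i \<le> 1\<close>.\<close>
    moreover from diff have "\<bar>t - x i\<bar> = (1 - lam i) * \<bar>xbar - x i\<bar>"
      using lam by (simp add: abs_mult)
    ultimately have "f (x i) + \<phi> (x i) * ((1 - lam i) * (xbar - x i))
        + f ((1 - lam i) * \<bar>xbar - x i\<bar>) \<le> f t"
      using assms(2)[OF assms(3)[OF i], of t] by simp
    \<comment> \<open>Moving the \<phi> term to the other side turns \<open>xbar - x i\<close> into
      \<open>x i - xbar\<close>.\<close>
    from mult_left_mono[OF this assms(4)[OF i]] show ?thesis
      unfolding t_def by (simp add: algebra_simps)
  qed
  then have "(\<Sum>i=1..n. a i * f (x i) - a i * f ((1 - lam i) * xbar + lam i * x i))
      \<le> (\<Sum>i=1..n. a i * (1 - lam i) * \<phi> (x i) * (x i - xbar)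
            - a i * f ((1 - lam i) * \<bar>xbar - x i\<bar>))"
    by (rule sum_mono)
  then show ?thesis
    using \<open>A > 0\<close>
    by (simp add: sum_subtractf divide_right_mono flip: diff_divide_distrib)
qed

end
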